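(* Every connected cubic graph $G$ with $n$ vertices satisfies $\tfrac{2}{5}n \le \gamma_I^p(G) \le \tfrac{2}{3}n$. Moreover, these bounds are tight: there is a connected cubic graph $G$ on $n$ vertices with $\gamma_I^p(G)=\lceil 2n/5\rceil$, and there is a connected cubic graph $G$ on $n$ vertices with $\gamma_I^p(G)=2n/3$.
   Context: All graphs are finite, simple and undirected; a cubic graph is a 3-regular graph. For a graph $G=(V,E)$ and $v\in V$, $N(v)$ denotes the set of neighbours of $v$. A perfect Italian dominating function (PID-function) of $G$ is a function $f:V\to\{0,1,2\}$ such that for every vertex $v$ with $f(v)=0$ one has $\sum_{u\in N(v)} f(u)=2$. The weight of $f$ is $\sum_{v\in V} f(v)$. The perfect Italian domination number $\gamma_I^p(G)$ is the minimum weight of a PID-function of $G$. *)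

theory Defs
  imports Complex_Main "Graph_Theory.Pair_Digraph" "Graph_Theory.Digraph_Component"
begin

text \<open>
  A finite simple undirected graph is a \<open>pair_graph\<close>: every edge \<open>{u, v}\<close> is represented by the
  two arcs \<open>(u, v)\<close> and \<open>(v, u)\<close>. Hence the degree of a vertex is its out-degree, and its
  neighbours are its out-neighbours. The predicate \<open>connected\<close> includes nonemptiness.
\<close>

definition neighbours :: "'a pair_pre_digraph \<Rightarrow> 'a \<Rightarrow> 'a set" where
  "neighbours G v = {u \<in> pverts G. (v, u) \<in> parcs G}"

definition cubic_graph :: "'a pair_pre_digraph \<Rightarrow> bool" where
  "cubic_graph G \<longleftrightarrow> pair_graph G \<and> (\<forall>v\<in>pverts G. out_degree (with_proj G) v = 3)"

text \<open>
  A labelling is a function on the whole vertex type, of which only the values on the vertices of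
  the graph matter.
\<close>

definition PID_function :: "'a pair_pre_digraph \<Rightarrow> ('a \<Rightarrow> nat) \<Rightarrow> bool" where
  "PID_function G f \<longleftrightarrow>
     (\<forall>v\<in>pverts G. f v \<in> {0, 1, 2}) \<and>
     (\<forall>v\<in>pverts G. f v = 0 \<longrightarrow> (\<Sum>u\<in>neighbours G v. f u) = 2)"

definition weight :: "'a pair_pre_digraph \<Rightarrow> ('a \<Rightarrow> nat) \<Rightarrow> nat" where
  "weight G f = (\<Sum>v\<in>pverts G. f v)"

text \<open>The minimum exists because the constant function 1 is a PID-function of every graph.\<close>

definition perfect_italian_domination_number :: "'a pair_pre_digraph \<Rightarrow> nat" where
  "perfect_italian_domination_number G = (LEAST w. \<exists>f. PID_function G f \<and> weight G f = w)"

end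

theory Submission
  imports Defs
begin

text \<open>
  Lower bound: the neighbourhood sums of the vertices labelled 0 total twice their number and at
  most three times the weight.

  Upper bound: if \<open>S\<close> is the vertex set of an induced matching of a cubic graph, then labelling
  \<open>S\<close> with 0 and all other vertices with 1 gives a PID-function, so it suffices to find such an
  \<open>S\<close> with at least a third of the vertices. This is proved for all graphs of maximum degree 3
  without a component isomorphic to \<open>K\<^bsub>3,3\<^esub>\<close> with one subdivided edge, where isolated vertices are
  not counted: put an edge into the matching and delete its closed neighbourhood. The induction
  works if the deleted vertices together with the newly isolated ones number at most 6. If every
  edge needs 7 vertices, then there is no vertex of degree 1, a vertex of degree 2 lies
  in a component that is the excluded graph, and a graph with all degrees 3 has no edge at all. A
  subdivided \<open>K\<^bsub>3,3\<^esub>\<close> hanging at its degree 2 vertex is destroyed first, so that no excluded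
  component ever arises.
\<close>

section \<open>Large induced matchings in subcubic graphs\<close>

text \<open>
  A graph is given by its neighbourhood function, which is empty outside the vertex set; isolated
  vertices are therefore invisible.
\<close>

definition non_isolated :: "('a \<Rightarrow> 'a set) \<Rightarrow> 'a set" where
  "non_isolated N = {v. N v \<noteq> {}}"

definition delete_vertices :: "('a \<Rightarrow> 'a set) \<Rightarrow> 'a set \<Rightarrow> 'a \<Rightarrow> 'a set" where
  "delete_vertices N D v = (if v \<in> D then {} else N v - D)"

text \<open>This is what disappears when \<open>D\<close> is deleted: \<open>D\<close> itself and
  the vertices that become isolated. Its size is the cost of a reduction step in the
  induction.\<close>

definition swallowed :: "('a \<Rightarrow> 'a set) \<Rightarrow> 'a set \<Rightarrow> 'a set" where
  "swallowed N D = D \<union> {v. N v \<noteq> {} \<and> N v \<subseteq> D}"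

text \<open>
  \<open>K\<^bsub>3,3\<^esub>\<close> with parts \<open>{x, p, q}\<close> and \<open>{y, s, t}\<close> whose edge \<open>xy\<close> is subdivided by \<open>u\<close>. The vertex
  \<open>u\<close> may have a third neighbour, which attaches the configuration to the rest of the graph.
\<close>

definition subdivided_K33 ::
    "('a \<Rightarrow> 'a set) \<Rightarrow> 'a \<Rightarrow> 'a \<Rightarrow> 'a \<Rightarrow> 'a \<Rightarrow> 'a \<Rightarrow> 'a \<Rightarrow> 'a \<Rightarrow> bool" where
  "subdivided_K33 N u x y s t p q \<longleftrightarrow> distinct [u, x, y, s, t, p, q] \<and>
     N x = {u, s, t} \<and> N y = {u, p, q} \<and> N s = {x, p, q} \<and> N t = {x, p, q} \<and>
     N p = {y, s, t} \<and> N q = {y, s, t}"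

section \<open>Neighbourhoods of at most three vertices\<close>

locale subcubic =
  fixes N :: "'a \<Rightarrow> 'a set"
  assumes finite_non_isolated: "finite (non_isolated N)"
    and sym: "u \<in> N v \<Longrightarrow> v \<in> N u"
    and irrefl: "v \<notin> N v"
    and degree_le: "card (N v) \<le> 3"
begin

lemma finite_neighbours: "finite (N v)"
  by (rule finite_subset[OF _ finite_non_isolated]) (auto simp: non_isolated_def dest: sym)

text \<open>The vertices \<open>b\<close> and \<open>c\<close> may coincide with each other or with
  \<open>a\<close>, so one equation covers degrees 1, 2 and 3.\<close>

lemma neighbours_one: "a \<in> N v \<Longrightarrow> \<exists>b c. N v = {a, b, c}"
proof -
  assume a: "a \<in> N v"
  have f: "finite (N v - {a})" using finite_neighbours by auto
  have "card (N v - {a}) \<le> 2" using a degree_le[of v] by simp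
  then consider "card (N v - {a}) = 0" | "card (N v - {a}) = 1" | "card (N v - {a}) = 2" by linarith
  then show ?thesis
  proof cases
    case 1 then have "N v - {a} = {}" using f by (simp only: card_0_eq)
    then have "N v = {a, a, a}" using a by auto
    then show ?thesis by blast
  next
    case 2 then obtain b where "N v - {a} = {b}" by (auto simp: card_1_singleton_iff)
    then have "N v = {a, b, b}" using a by auto
    then show ?thesis by blast
  next
    case 3 then obtain b c where "N v - {a} = {b, c}" by (auto simp: card_2_iff)
    then have "N v = {a, b, c}" using a by auto
    then show ?thesis by blast
  qed
qed

lemma neighbours_two:
  assumes "a \<in> N v" "b \<in> N v" "a \<noteq> b"
  shows "\<exists>c. N v = {a, b, c}"
  using neighbours_one[OF assms(1)] assms by auto

lemma neighbours_three:
  assumes "a \<in> N v" "b \<in> N v" "c \<in> N v" "distinct [a, b, c]"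
  shows "N v = {a, b, c}"
  using neighbours_two[OF assms(1,2)] assms by auto

lemma subcubic_delete_vertices: "subcubic (delete_vertices N D)"
proof
  show "finite (non_isolated (delete_vertices N D))"
    by (rule finite_subset[OF _ finite_non_isolated])
       (auto simp: non_isolated_def delete_vertices_def split: if_splits)
  show "card (delete_vertices N D v) \<le> 3" for v
    using card_mono[OF finite_neighbours, of "N v - D" v] degree_le[of v]
    by (auto simp: delete_vertices_def)
qed (auto simp: delete_vertices_def irrefl dest: sym split: if_splits)

end

section \<open>Every edge swallows at least 7 vertices: no vertex of degree 1\<close>

locale large_swallowed = subcubic +
  assumes large: "y \<in> N x \<Longrightarrow> 7 \<le> card (swallowed N (N x \<union> N y))"
begin

text \<open>A matching edge adds two vertices to \<open>S\<close> and so may cost 6. Most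
  contradictions below arise here, from an edge and a list that contains all it swallows. The list
  may have repetitions, so coincidences between its entries need no separate treatment.\<close>

lemma swallowed_le_6:
  assumes "y \<in> N x" "N x \<union> N y \<subseteq> set l" "length l \<le> 6"
    and "\<And>z. N z \<noteq> {} \<Longrightarrow> N z \<subseteq> N x \<union> N y \<Longrightarrow> z \<notin> set l \<Longrightarrow> False"
  shows False
proof -
  have "swallowed N (N x \<union> N y) \<subseteq> set l"
    using assms(2,4) by (auto simp: swallowed_def)
  then have "card (swallowed N (N x \<union> N y)) \<le> card (set l)"
    by (rule card_mono[rotated]) simp
  also have "\<dots> \<le> 6" using card_length[of l] assms(3) by simp
  finally show False using large[OF assms(1)] by simp
qed

text \<open>The situation left over in \<open>no_leaf\<close>: \<open>p1\<close>, \<open>p2\<close>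
  and \<open>q1\<close> are swallowed with the edge \<open>va\<close>, two of them at
  \<open>p\<close> and one at \<open>q\<close>. Then an edge at \<open>q\<close> or at
  \<open>p\<close> is cheap.\<close>

lemma no_leaf_aux:
  assumes v: "N v = {a}" and a: "N a = {v, p, q}"
    and p: "p1 \<in> N p" "p2 \<in> N p" "p1 \<noteq> p2" "q1 \<in> N q" "q1 \<notin> {p1, p2}"
    and d: "{p1, p2, q1} \<inter> {v, a, p, q} = {}"
    and s: "N p1 \<subseteq> {p, q}" "N p2 \<subseteq> {p, q}" "N q1 \<subseteq> {p, q}"
  shows False
proof -
  have ap: "a \<in> N p" "a \<in> N q" using a sym by auto
  have Np: "N p = {a, p1, p2}" using neighbours_three[of a p p1 p2] ap p d by auto
  have "p \<notin> N q1" using sym[of p q1] Np p d by auto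
  then have q1: "N q1 = {q}" using s(3) sym[OF p(4)] by auto
  obtain q2 where Nq: "N q = {a, q1, q2}" using neighbours_two[of a q q1] ap p d by auto
  have pq: "p \<noteq> q" using p(4,5) Np d by auto
  \<comment> \<open>If the third neighbour \<open>r\<close> of \<open>q\<close> is also adjacent to
    \<open>p\<close>, the edge from \<open>q\<close> to \<open>q1\<close> can swallow only
    \<open>v\<close> and \<open>p\<close> outside its closed neighbourhood.\<close>
  have *: False if "q2 = r" "r \<in> N p" "N r \<subseteq> {p, q}" "r \<noteq> a" for r
  proof -
    have r: "N r = {p, q}" using that sym[of r p] sym[of r q] Nq by auto
    show False
    proof (rule swallowed_le_6[of q1 q "[a, q1, r, q, v, p]"])
      fix z assume z: "N z \<noteq> {}" "N z \<subseteq> N q \<union> N q1" "z \<notin> set [a, q1, r, q, v, p]"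
      then obtain w where "w \<in> N z" by auto
      then have "z \<in> N w" "w \<in> N q \<union> N q1" using z sym by auto
      then show False using z(3) Nq q1 r a that by auto
    qed (use Nq q1 that in auto)
  qed
  show False
  proof (cases "q2 = p1 \<or> q2 = p2")
    case True
    then show False using * p s d by auto
  next
    case False
    \<comment> \<open>Now \<open>p1\<close> and \<open>p2\<close> are leaves at \<open>p\<close>.
      The edge from \<open>p\<close> to \<open>p1\<close> can swallow only \<open>v\<close> in
      addition, because \<open>q\<close> keeps its neighbour \<open>q1\<close>.\<close>
    then have np: "N p1 = {p}" "N p2 = {p}"
      using Nq s sym[of q p1] sym[of q p2] p(5) d sym[OF p(1)] sym[OF p(2)] by auto
    show False
    proof (rule swallowed_le_6[of p1 p "[a, p1, p2, p, v]"])
      fix z assume z: "N z \<noteq> {}" "N z \<subseteq> N p \<union> N p1" "z \<notin> set [a, p1, p2, p, v]"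
      then obtain w where "w \<in> N z" by auto
      then have "z \<in> N w" "w \<in> N p \<union> N p1" using z sym by auto
      then have "z = q" using z(3) Np np a by auto
      then show False using z(2) p(4,5) Np np d by auto
    qed (use Np np p in auto)
  qed
qed

text \<open>The edge at the leaf has at most 4 vertices in its closed neighbourhood, so at least 3
  more are swallowed, all of them among \<open>p1\<close>, \<open>p2\<close>, \<open>q1\<close>,
  \<open>q2\<close>. By pigeonhole they include both vertices at \<open>p\<close> or both at
  \<open>q\<close>, plus one at the other.\<close>

lemma no_leaf: "N v \<noteq> {a}"
proof
  assume v: "N v = {a}"
  then have "v \<in> N a" using sym by auto
  then obtain p q where a: "N a = {v, p, q}" using neighbours_one by blast
  then have ap: "a \<in> N p" "a \<in> N q" using sym by auto
  obtain p1 p2 where p: "N p = {a, p1, p2}" using neighbours_one[OF ap(1)] by blast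
  obtain q1 q2 where q: "N q = {a, q1, q2}" using neighbours_one[OF ap(2)] by blast
  define I where "I = swallowed N {v, a, p, q} - {v, a, p, q}"
  have I: "N z \<subseteq> {p, q}" "z \<in> {p1, p2, q1, q2}" "z \<notin> {v, a, p, q}" if z: "z \<in> I" for z
  proof -
    have zz: "N z \<noteq> {}" "N z \<subseteq> {v, a, p, q}" "z \<notin> {v, a, p, q}"
      using z by (auto simp: I_def swallowed_def)
    have "v \<notin> N z" "a \<notin> N z" using zz(3) v a sym[of v z] sym[of a z] by auto
    then show "N z \<subseteq> {p, q}" using zz by auto
    then have "z \<in> N p \<or> z \<in> N q" using zz sym by blast
    then show "z \<in> {p1, p2, q1, q2}" using zz p q by auto
    show "z \<notin> {v, a, p, q}" by fact
  qed
  have Ifin: "finite I" using I(2) by (rule finite_subset[OF subsetI]) auto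
  have "7 \<le> card (swallowed N (N v \<union> N a))" using large[of a v] v by auto
  also have "N v \<union> N a = {v, a, p, q}" using v a by auto
  also have "card (swallowed N {v, a, p, q}) \<le> card (I \<union> {v, a, p, q})"
    by (rule card_mono) (use Ifin in \<open>auto simp: I_def\<close>)
  also have "\<dots> \<le> card I + card {v, a, p, q}" by (rule card_Un_le)
  also have "\<dots> \<le> card I + 4" using card_length[of "[v, a, p, q]"] by auto
  finally have I3: "3 \<le> card I" by simp
  have small: False if "I \<subseteq> {b, c}" for b c
    using card_mono[OF _ that] card_length[of "[b, c]"] I3 by auto
  have p_pair: False if "p1 \<in> I" "p2 \<in> I" "p1 \<noteq> p2"
  proof -
    obtain r where r: "r \<in> I" "r \<notin> {p1, p2}" using small[of p1 p2] by blast
    then have "r \<in> N q" using I(2) q by blast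
    then show False using no_leaf_aux[OF v a, of p1 p2 r] I that r p by blast
  qed
  have a': "N a = {v, q, p}" using a by auto
  have q_pair: False if "q1 \<in> I" "q2 \<in> I" "q1 \<noteq> q2"
  proof -
    obtain r where r: "r \<in> I" "r \<notin> {q1, q2}" using small[of q1 q2] by blast
    then have "r \<in> N p" using I(2) p by blast
    then show False using no_leaf_aux[OF v a', of q1 q2 r] I that r q by blast
  qed
  have "(\<exists>b. I \<inter> {p1, p2} \<subseteq> {b})" "(\<exists>b. I \<inter> {q1, q2} \<subseteq> {b})" using p_pair q_pair by blast+
  then obtain b c where "I \<inter> {p1, p2} \<subseteq> {b}" "I \<inter> {q1, q2} \<subseteq> {c}" by auto
  then have "I \<subseteq> {b, c}" using I(2) by blast
  then show False by (rule small)
qed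

section \<open>Vertices of degree 2\<close>

lemma closed_neighbourhood_ge_5:
  assumes "y \<in> N x" "N x \<union> N y = {x, y, p, q}"
  shows False
proof -
  have "\<exists>w \<in> {x, y}. w \<in> N p" using assms(2) sym by auto
  then obtain w p1 p2 where w: "w \<in> {x, y}" "N p = {w, p1, p2}" using neighbours_one by blast
  show False
  \<comment> \<open>A swallowed vertex outside the closed neighbourhood is adjacent to
    \<open>p\<close> and \<open>q\<close> only, and to both as there are no leaves. It is thus one
    of the at most two remaining neighbours of \<open>p\<close>.\<close>
  proof (rule swallowed_le_6[OF assms(1), of "[x, y, p, q, p1, p2]"])
    fix z assume z: "N z \<noteq> {}" "N z \<subseteq> N x \<union> N y" "z \<notin> set [x, y, p, q, p1, p2]"
    have "x \<notin> N z" "y \<notin> N z" using assms(2) z(3) sym[of x z] sym[of y z] by auto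
    moreover have "p \<notin> N z" using w z(3) sym[of p z] by auto
    ultimately have "N z \<subseteq> {q}" using z(2) assms(2) by auto
    then have "N z = {q}" using z(1) by auto
    then show False using no_leaf by blast
  qed (use assms in auto)
qed

text \<open>The edge \<open>ux\<close> has 5 vertices in its closed neighbourhood, so two more,
  \<open>v\<close> and \<open>w\<close>, are swallowed, with all neighbours among \<open>y\<close>,
  \<open>s\<close>, \<open>t\<close>. Were one of them not adjacent to \<open>y\<close>, an edge at
  it would be cheap. So both are adjacent to \<open>y\<close>.\<close>

lemma degree_two_opposite:
  assumes u: "N u = {x, y}" and xy: "x \<noteq> y" and x: "N x = {u, s, t}"
  shows "distinct [u, x, y, s, t]"
    and "\<exists>p q. N y = {u, p, q} \<and> p \<noteq> q \<and> {p, q} \<inter> {u, x, y, s, t} = {} \<and>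
       N p \<subseteq> {y, s, t} \<and> N q \<subseteq> {y, s, t}"
proof -
  have D: "N u \<union> N x = {u, x, y, s, t}" using u x by auto
  have xu: "x \<in> N u" using u by auto
  have un: "u \<in> N x" "u \<in> N y" using u sym by auto
  have ne: "u \<noteq> x" "u \<noteq> y" "x \<noteq> s" "x \<noteq> t" using irrefl u x by blast+
  \<comment> \<open>Any coincidence among the five vertices would leave a closed neighbourhood of at
    most 4.\<close>
  have four: "N u \<union> N x \<noteq> {u, x, c, d}" for c d
    using closed_neighbourhood_ge_5[OF xu] by blast
  have "s \<noteq> t" using four[of y s] D by auto
  moreover have "y \<noteq> s" using four[of s t] D by auto
  moreover have "y \<noteq> t" using four[of s t] D by auto
  moreover have "u \<noteq> s" using four[of y t] D by auto
  moreover have "u \<noteq> t" using four[of y s] D by auto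
  ultimately show dist: "distinct [u, x, y, s, t]" using ne xy by auto
  define I where "I = swallowed N {u, x, y, s, t} - {u, x, y, s, t}"
  have I: "N z \<subseteq> {y, s, t}" "N z \<noteq> {}" "z \<notin> {u, x, y, s, t}" if z: "z \<in> I" for z
  proof -
    have zz: "N z \<noteq> {}" "N z \<subseteq> {u, x, y, s, t}" "z \<notin> {u, x, y, s, t}"
      using z by (auto simp: I_def swallowed_def)
    moreover have "u \<notin> N z" "x \<notin> N z" using zz(3) u x sym[of u z] sym[of x z] by auto
    ultimately show "N z \<subseteq> {y, s, t}" "N z \<noteq> {}" "z \<notin> {u, x, y, s, t}" by auto
  qed
  have "\<exists>v\<in>I. \<exists>w\<in>I. v \<noteq> w"
  proof (rule ccontr)
    assume "\<not> ?thesis"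
    then obtain r where "I \<subseteq> {r}" by blast
    then have "swallowed N (N u \<union> N x) \<subseteq> set [u, x, y, s, t, r]"
      unfolding D by (auto simp: I_def)
    from card_mono[OF _ this] have "card (swallowed N (N u \<union> N x)) \<le> 6"
      using card_length[of "[u, x, y, s, t, r]"] by (simp del: set_simps)
    then show False using large[OF xu] by simp
  qed
  then obtain v w where vw: "v \<in> I" "w \<in> I" "v \<noteq> w" by blast
  have key: False if w: "w \<in> I" "y \<notin> N w" and v: "v \<in> I" "v \<noteq> w" for v w
  proof -
    have Nw: "N w = {s, t}" using I(1)[OF w(1)] I(2)[OF w(1)] w(2) no_leaf[of w s] no_leaf[of w t] by blast
    \<comment> \<open>Here \<open>s'\<close> is the one of \<open>s\<close> and \<open>t\<close>
      that is adjacent to \<open>v\<close>. The edge from \<open>w\<close> to \<open>s'\<close> is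
      cheap: outside the list, a swallowed vertex at \<open>x\<close> would be \<open>u\<close>,
      which keeps \<open>y\<close>, and any other would be a leaf at \<open>v\<close>.\<close>
    have aux: False if x': "N x = {u, s', t'}" and st: "{s', t'} = {s, t}" and sv: "s' \<in> N v"
      for s' t'
    proof -
      have ns: "N s' = {x, v, w}"
        using neighbours_three[of x s' v w] sym[OF sv] sym[of s' x] sym[of s' w] x' Nw st
          I(3)[OF v(1)] I(3)[OF w(1)] v(2) by auto
      have "x \<in> N t'" "w \<in> N t'" "x \<noteq> w" using sym[of t' x] sym[of t' w] x' Nw st I(3)[OF w(1)] by auto
      then obtain t3 where nt: "N t' = {x, w, t3}" using neighbours_two by metis
      have D': "N w \<union> N s' = {s', t', x, v, w}" using Nw ns st by auto
      show False
      proof (rule swallowed_le_6[of s' w "[s', t', x, v, w, t3]"])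
        fix z assume z: "N z \<noteq> {}" "N z \<subseteq> N w \<union> N s'" "z \<notin> set [s', t', x, v, w, t3]"
        have "s' \<notin> N z" "w \<notin> N z" "t' \<notin> N z"
          using z(3) ns nt Nw st sym[of s' z] sym[of t' z] sym[of w z] by auto
        moreover have "x \<notin> N z"
        proof
          assume "x \<in> N z"
          then have "z = u" using z(3) sym[of x z] x' by auto
          then have "y \<in> {s', t', x, v, w}" using z(2) u D' by auto
          then show False using dist st I(3)[OF v(1)] I(3)[OF w(1)] by auto
        qed
        ultimately have "N z \<subseteq> {v}" using z(2) D' by auto
        then have "N z = {v}" using z(1) by auto
        then show False using no_leaf by blast
      qed (use Nw ns st in auto)
    qed
    have "s \<in> N v \<or> t \<in> N v" using I(1)[OF v(1)] I(2)[OF v(1)] no_leaf[of v y] by blast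
    then show False using aux[of s t] aux[of t s] x by auto
  qed
  have "y \<in> N v" "y \<in> N w" using key[of v w] key[of w v] vw by blast+
  then have "v \<in> N y" "w \<in> N y" using sym by auto
  then have "N y = {u, v, w}"
    using neighbours_three[of u y v w] un vw I(3)[OF vw(1)] I(3)[OF vw(2)] by auto
  moreover have "{v, w} \<inter> {u, x, y, s, t} = {}" using I(3) vw by auto
  ultimately show "\<exists>p q. N y = {u, p, q} \<and> p \<noteq> q \<and> {p, q} \<inter> {u, x, y, s, t} = {} \<and>
       N p \<subseteq> {y, s, t} \<and> N q \<subseteq> {y, s, t}" using I(1) vw by blast
qed

text \<open>Without the edge \<open>sp\<close>, the closed neighbourhood of \<open>sx\<close> is
  \<open>u, x, s, t, q\<close>. Only \<open>p\<close> or \<open>y\<close> could be swallowed in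
  addition, but they are adjacent to each other and both remain.\<close>

lemma degree_two_missing_edge:
  assumes "distinct [u, x, y, s, t, p, q]" "N u = {x, y}" "N x = {u, s, t}" "N y = {u, p, q}"
    "N s \<subseteq> {x, p, q}" "N t \<subseteq> {x, p, q}" "N p \<subseteq> {y, s, t}" "N q \<subseteq> {y, s, t}"
  shows "p \<in> N s"
proof (rule ccontr)
  assume ps: "p \<notin> N s"
  have xs: "x \<in> N s" using sym assms(3) by auto
  then have s: "N s = {x, q}" using no_leaf[of s x] assms(5) ps by auto
  have yp: "y \<in> N p" using sym assms(4) by auto
  have D: "N s \<union> N x = {u, x, s, t, q}" using s assms by auto
  show False
  proof (rule swallowed_le_6[of x s "[u, x, s, t, q]"])
    fix z assume z: "N z \<noteq> {}" "N z \<subseteq> N s \<union> N x" "z \<notin> set [u, x, s, t, q]"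
    then obtain w where w: "w \<in> N z" by auto
    then have "z \<in> N w" "w \<in> {u, x, s, t, q}" using z sym D by auto
    then have "z = p \<or> z = y" using z(3) assms s by auto
    then show False using z(2) D yp assms by auto
  qed (use s xs D in auto)
qed

text \<open>Applying \<open>degree_two_opposite\<close> from both sides of \<open>u\<close> confines
  the remaining edges to those between \<open>s, t\<close> and \<open>p, q\<close>. All four are
  present by \<open>degree_two_missing_edge\<close>.\<close>

lemma degree_two_subdivided_K33:
  assumes u: "N u = {x, y}" and xy: "x \<noteq> y"
  shows "\<exists>s t p q. subdivided_K33 N u x y s t p q"
proof -
  have "u \<in> N x" using u sym by auto
  then obtain s t where x: "N x = {u, s, t}" using neighbours_one by blast
  from degree_two_opposite[OF u xy x] obtain p q where d1: "distinct [u, x, y, s, t]"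
    and y: "N y = {u, p, q}" and pq: "p \<noteq> q" "{p, q} \<inter> {u, x, y, s, t} = {}"
      "N p \<subseteq> {y, s, t}" "N q \<subseteq> {y, s, t}" by blast
  have u': "N u = {y, x}" using u by auto
  from degree_two_opposite[OF u' xy[symmetric] y] obtain s' t' where
    x': "N x = {u, s', t'}" and st': "s' \<noteq> t'" "{s', t'} \<inter> {u, y, x, p, q} = {}"
      "N s' \<subseteq> {x, p, q}" "N t' \<subseteq> {x, p, q}" by blast
  have "{s', t'} = {s, t}" using x x' st' d1 by auto
  then have st: "N s \<subseteq> {x, p, q}" "N t \<subseteq> {x, p, q}" using st' by (auto simp: doubleton_eq_iff)
  have d: "distinct [u, x, y, s, t, p, q]" using d1 pq by auto
  have x2: "N x = {u, t, s}" and y2: "N y = {u, q, p}" using x y by auto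
  have p2: "N p \<subseteq> {y, t, s}" "N q \<subseteq> {y, t, s}" and s2: "N s \<subseteq> {x, q, p}" "N t \<subseteq> {x, q, p}"
    using pq st by auto
  have ed: "p \<in> N s" "q \<in> N s" "p \<in> N t" "q \<in> N t"
    using degree_two_missing_edge[of u x y s t p q] degree_two_missing_edge[of u x y s t q p]
      degree_two_missing_edge[of u x y t s p q] degree_two_missing_edge[of u x y t s q p]
      d u x y x2 y2 p2 s2 pq st by auto
  have xsy: "x \<in> N s" "x \<in> N t" "y \<in> N p" "y \<in> N q" using x y sym by auto
  have "N s = {x, p, q}" "N t = {x, p, q}" "N p = {y, s, t}" "N q = {y, s, t}"
    using ed ed[THEN sym] xsy st pq by blast+
  then show ?thesis unfolding subdivided_K33_def using d x y by blast
qed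

end

section \<open>All degrees equal to 3\<close>

locale large_swallowed_cubic = large_swallowed +
  assumes degree_eq: "N v \<noteq> {} \<Longrightarrow> card (N v) = 3"
begin

lemma three_neighbours:
  assumes "a \<in> N v" shows "\<exists>b c. N v = {a, b, c} \<and> distinct [a, b, c]"
proof -
  obtain b c where bc: "N v = {a, b, c}" using neighbours_one[OF assms] by blast
  then have "card {a, b, c} = 3" using degree_eq[of v] by auto
  then have "distinct [a, b, c]" using card_distinct[of "[a, b, c]"] by auto
  then show ?thesis using bc by blast
qed

lemma third_neighbour:
  assumes "a \<in> N v" "b \<in> N v" "a \<noteq> b"
  shows "\<exists>c. N v = {a, b, c} \<and> distinct [a, b, c]"
proof -
  obtain c d where "N v = {a, c, d}" "distinct [a, c, d]" using three_neighbours[OF assms(1)] by blast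
  then show ?thesis using assms by (intro exI[of _ "if b = c then d else c"]) auto
qed

lemma not_subset_pair: "N v \<noteq> {} \<Longrightarrow> \<not> N v \<subseteq> {a, b}"
  using degree_eq[of v] card_mono[of "{a, b}" "N v"] card_length[of "[a, b]"] by auto

text \<open>Let \<open>a\<close>, \<open>b\<close>, \<open>d\<close> be the third neighbours of the
  vertices of a triangle. A swallowed vertex beyond these six could be adjacent to \<open>a\<close>
  and \<open>b\<close> only, one neighbour too few.\<close>

lemma triangle_free:
  assumes "y \<in> N x" "c \<in> N x" shows "c \<notin> N y"
proof
  assume c: "c \<in> N y"
  have yx: "x \<in> N y" using assms sym by auto
  have ne: "x \<noteq> y" "c \<noteq> x" "c \<noteq> y" using assms c irrefl by blast+
  obtain a where a: "N x = {y, c, a}" using neighbours_two[OF assms] ne by auto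
  obtain b where b: "N y = {x, c, b}" using neighbours_two[OF yx c] ne by auto
  obtain d where d: "N c = {x, y, d}"
    using neighbours_two[of x c y] sym[OF assms(2)] sym[OF c] ne by auto
  show False
  proof (rule swallowed_le_6[OF assms(1), of "[x, y, c, a, b, d]"])
    fix z assume z: "N z \<noteq> {}" "N z \<subseteq> N x \<union> N y" "z \<notin> set [x, y, c, a, b, d]"
    have "x \<notin> N z" "y \<notin> N z" "c \<notin> N z"
      using z(3) a b d sym[of x z] sym[of y z] sym[of c z] by auto
    then have "N z \<subseteq> {a, b}" using z a b by auto
    then show False using not_subset_pair z(1) by blast
  qed (use a b in auto)
qed

text \<open>The closed neighbourhood of \<open>yb\<close> has at most six vertices, so a seventh,
  \<open>z\<close>, is swallowed, with three neighbours among \<open>x, b', v, d\<close>. If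
  \<open>z\<close> is \<open>a\<close>, then \<open>b'\<close> is excluded by
  \<open>triangle_free\<close> and \<open>d\<close> must occur. Otherwise \<open>v\<close> is
  excluded, and \<open>z\<close> is adjacent to \<open>x, b', d\<close>, which makes it
  \<open>a'\<close>.\<close>

lemma opposite_vertex_cases:
  assumes x: "N x = {y, a, a'}" "distinct [y, a, a']" and y: "N y = {x, b, b'}" "distinct [x, b, b']"
    and v: "N v = {a, b, b'}" and b: "N b = {y, v, d}" and vy: "v \<noteq> y"
  shows "d \<in> N a \<or> a' \<in> N b' \<and> d \<in> N a'"
proof (rule ccontr)
  assume no: "\<not> ?thesis"
  have av: "v \<in> N a" "v \<in> N b'" "x \<in> N a" "x \<in> N a'" "y \<in> N b'" using v x y sym by auto
  have ab': "b' \<notin> N a" using triangle_free[of v a b'] av sym[of b' v] v by auto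
  then have b'a: "a \<notin> N b'" using sym by auto
  obtain d' where b': "N b' = {y, v, d'}" using neighbours_two[of y b' v] av vy by auto
  obtain c where a: "N a = {x, v, c}" "distinct [x, v, c]"
    using third_neighbour[of x a v] av by (metis b y irrefl insertI1 insertI2 triangle_free)
  show False
  proof (rule swallowed_le_6[of y b "[x, b, b', y, v, d]"])
    fix z assume z: "N z \<noteq> {}" "N z \<subseteq> N b \<union> N y" "z \<notin> set [x, b, b', y, v, d]"
    have "b \<notin> N z" "y \<notin> N z" using z(3) b y sym[of b z] sym[of y z] by auto
    then have nz: "N z \<subseteq> {x, b', v, d}" using z(2) b y by auto
    have zx: "z \<in> {a, a'}" if "x \<in> N z" using sym[OF that] x z(3) by auto
    have zv: "z = a" if "v \<in> N z" using sym[OF that] v z(3) by auto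
    have zb: "z = d'" if "b' \<in> N z" using sym[OF that] b' z(3) by auto
    have za: "z \<noteq> a"
    proof
      assume "z = a"
      then have "N a \<subseteq> {x, v}" using nz ab' no by auto
      then show False using not_subset_pair[of a] av by auto
    qed
    then have vz: "v \<notin> N z" using zv by auto
    have "d \<notin> N z"
    proof
      assume dz: "d \<in> N z"
      show False
      proof (cases "x \<in> N z")
        case True
        then have "z = a'" using zx za by auto
        then have "b' \<notin> N z" using no dz sym by auto
        then show False using nz vz not_subset_pair[OF z(1), of x d] by auto
      next
        case False
        then show False using nz vz not_subset_pair[OF z(1), of b' d] by auto
      qed
    qed
    then show False using nz vz not_subset_pair[OF z(1), of x b'] by auto
  qed (use b y in auto)
qed

lemma no_opposite_vertex:
  assumes x: "N x = {y, a, a'}" "distinct [y, a, a']" and y: "N y = {x, b, b'}" "distinct [x, b, b']"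
    and v: "N v = {a, b, b'}" and vy: "v \<noteq> y" "v \<noteq> x"
  shows False
proof -
  have av: "v \<in> N a" "v \<in> N b" "v \<in> N b'" "x \<in> N a" "x \<in> N a'" "y \<in> N b" "y \<in> N b'"
    using v x y sym by auto
  obtain d where b: "N b = {y, v, d}" "distinct [y, v, d]" using third_neighbour[of y b v] av vy by auto
  obtain d' where b': "N b' = {y, v, d'}" "distinct [y, v, d']"
    using third_neighbour[of y b' v] av vy by auto
  obtain c where a: "N a = {x, v, c}" "distinct [x, v, c]" using third_neighbour[of x a v] av vy by auto
  have y': "N y = {x, b', b}" "distinct [x, b', b]" and v': "N v = {a, b', b}" using y v by auto
  have xb: "x \<notin> N b" "x \<notin> N b'" using triangle_free[of b y x] triangle_free[of b' y x] y by auto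
  then have dx: "d \<noteq> x" "d' \<noteq> x" using b b' by auto
  have aa': "a' \<notin> N a" using triangle_free[of a x a'] x by auto
  have a'v: "a' \<noteq> v" using triangle_free[of a x v] av x by auto
  have a'y: "a' \<noteq> y" using x by auto
  \<comment> \<open>The second instance exchanges \<open>b\<close> and \<open>b'\<close>.\<close>
  from opposite_vertex_cases[OF x y v b(1) vy(1)] opposite_vertex_cases[OF x y' v' b'(1) vy(1)]
  consider "d \<in> N a" "d' \<in> N a" | "d \<in> N a" "a' \<in> N b" | "a' \<in> N b'" "d' \<in> N a"
    | "d \<in> N a'" "a' \<in> N b" by blast
  then show False
  proof cases
    case 1
    \<comment> \<open>Here \<open>d\<close> and \<open>v\<close> have the same neighbours, so
      outside its closed neighbourhood the edge \<open>vb\<close> could swallow only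
      \<open>x\<close>, which keeps \<open>a'\<close>.\<close>
    then have dc: "d = c" "d' = c" using a dx b b' by auto
    have ab: "a \<noteq> b" "a \<noteq> b'" "b \<noteq> b'" using av xb y by auto
    have "a \<in> N d" "b \<in> N d" "b' \<in> N d" using dc a b b' sym by auto
    then have Nd: "N d = {a, b, b'}" using neighbours_three ab by auto
    show False
    proof (rule swallowed_le_6[of v b "[y, v, d, a, b, b']"])
      fix z assume z: "N z \<noteq> {}" "N z \<subseteq> N b \<union> N v" "z \<notin> set [y, v, d, a, b, b']"
      then obtain w where "w \<in> N z" by auto
      then have "z \<in> N w" "w \<in> {y, v, d, a, b, b'}" using z(2) sym b v by auto
      then have "z = x" using z(3) y v Nd a b b' dc by auto
      then have "a' \<in> {y, v, d, a, b, b'}" using z(2) x b v by auto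
      then show False using x a'v aa' av xb 1 by auto
    qed (use b v in auto)
  next
    \<comment> \<open>Here \<open>a'\<close> is \<open>d\<close>, which closes the triangle
      \<open>x, a, a'\<close>. The next case is symmetric, and in the last one \<open>a'\<close>
      would be its own neighbour.\<close>
    case 2 then show False using b a'v a'y aa' by auto
  next
    case 3 then show False using b' a'v a'y aa' by auto
  next
    case 4 then show False using b a'v a'y irrefl by auto
  qed
qed

text \<open>A swallowed vertex outside the closed neighbourhood has three of its neighbours among
  \<open>a, a', b, b'\<close>, hence both from one end of the edge and one from the other. Each of
  the four choices is an instance of \<open>no_opposite_vertex\<close>.\<close>

lemma no_edge: "y \<notin> N x"
proof
  assume yx: "y \<in> N x"
  then have xy: "x \<in> N y" using sym by auto
  obtain a a' where x: "N x = {y, a, a'}" "distinct [y, a, a']" using three_neighbours[OF yx] by auto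
  obtain b b' where y: "N y = {x, b, b'}" "distinct [x, b, b']" using three_neighbours[OF xy] by auto
  show False
  proof (rule swallowed_le_6[OF yx, of "[x, y, a, a', b, b']"])
    fix z assume z: "N z \<noteq> {}" "N z \<subseteq> N x \<union> N y" "z \<notin> set [x, y, a, a', b, b']"
    have xyz: "x \<notin> N z" "y \<notin> N z" using z(3) x y sym[of x z] sym[of y z] by auto
    then have nz: "N z \<subseteq> {a, a', b, b'}" using z(2) x y by auto
    obtain e where e: "e \<in> N z" using z by auto
    obtain f g where fg: "N z = {e, f, g}" "distinct [e, f, g]" using three_neighbours[OF e] by auto
    have "N z = {a, b, b'} \<or> N z = {a', b, b'} \<or> N z = {b, a, a'} \<or> N z = {b', a, a'}"
      using nz fg by auto
    moreover have x': "N x = {y, a', a}" "distinct [y, a', a]" using x by auto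
    moreover have y': "N y = {x, b', b}" "distinct [x, b', b]" using y by auto
    ultimately show False
      using no_opposite_vertex[OF x y] no_opposite_vertex[OF x' y]
        no_opposite_vertex[OF y x] no_opposite_vertex[OF y' x] z(3) by auto
  qed (use x y in auto)
qed

end

section \<open>Avoiding the excluded component, and the induction\<close>

definition no_subdivided_K33_component :: "('a \<Rightarrow> 'a set) \<Rightarrow> bool" where
  "no_subdivided_K33_component N \<longleftrightarrow>
     (\<forall>u x y s t p q. subdivided_K33 N u x y s t p q \<longrightarrow> N u \<noteq> {x, y})"

context subcubic
begin

text \<open>The six vertices other than \<open>u\<close> have degree 3 after the deletion, so they
  lost no neighbour. Only \<open>u\<close> can have lost one: an excluded component arises only from
  a configuration that was already there.\<close>

lemma subdivided_K33_delete_vertices: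
  assumes K: "subdivided_K33 (delete_vertices N D) u x y s t p q"
  shows "subdivided_K33 N u x y s t p q"
proof -
  have full: "delete_vertices N D v = A \<Longrightarrow> N v = A" if "card A = 3" for v A
  proof -
    assume A: "delete_vertices N D v = A"
    have "A \<subseteq> N v" using A by (auto simp: delete_vertices_def split: if_splits)
    moreover have "card (N v) = card A"
      using card_mono[OF finite_neighbours \<open>A \<subseteq> N v\<close>] degree_le[of v] that by simp
    ultimately show "N v = A" using card_subset_eq[OF finite_neighbours, of A v] by simp
  qed
  show ?thesis
    using K unfolding subdivided_K33_def by (auto intro!: full)
qed

text \<open>The edge \<open>sp\<close> removes exactly the six vertices other than \<open>u\<close>,
  and \<open>u\<close> survives through its third neighbour. Among the surviving vertices only
  \<open>u\<close> loses neighbours, and it is left with degree 1, so no new vertex of degree 2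
  appears.\<close>

lemma delete_pendant_subdivided_K33:
  assumes K: "subdivided_K33 N u x y s t p q" and pendant: "N u \<noteq> {x, y}"
  shows "card (swallowed N (N s \<union> N p)) \<le> 6"
    and "subdivided_K33 (delete_vertices N (N s \<union> N p)) u' x' y' s' t' p' q' \<Longrightarrow>
      delete_vertices N (N s \<union> N p) u' = {x', y'} \<Longrightarrow> N u' = {x', y'}"
proof -
  have d: "distinct [u, x, y, s, t, p, q]"
    and N: "N x = {u, s, t}" "N y = {u, p, q}" "N s = {x, p, q}" "N t = {x, p, q}"
      "N p = {y, s, t}" "N q = {y, s, t}"
    using K by (auto simp: subdivided_K33_def)
  have D: "N s \<union> N p = {x, y, s, t, p, q}" using N by auto
  have xyu: "x \<in> N u" "y \<in> N u" "x \<noteq> y" using N sym d by auto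
  obtain c where c: "N u = {x, y, c}" using neighbours_two[OF xyu] by blast
  have "s \<notin> N u" "t \<notin> N u" "p \<notin> N u" "q \<notin> N u"
    using N d sym[of s u] sym[of t u] sym[of p u] sym[of q u] by auto
  then have c': "c \<notin> N s \<union> N p" using D c pendant by auto
  have only_u: "z = u" if "w \<in> N z" "w \<in> N s \<union> N p" "z \<notin> N s \<union> N p" for w z
    using sym[OF that(1)] that(2,3) N by auto
  have "swallowed N (N s \<union> N p) \<subseteq> set [x, y, s, t, p, q]"
  proof
    fix z assume z: "z \<in> swallowed N (N s \<union> N p)"
    show "z \<in> set [x, y, s, t, p, q]"
    proof (rule ccontr)
      assume "z \<notin> set [x, y, s, t, p, q]"
      then have zz: "z \<notin> N s \<union> N p" "N z \<noteq> {}" "N z \<subseteq> N s \<union> N p"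
        using z D by (auto simp: swallowed_def)
      then have "z = u" using only_u by blast
      then show False using c c' zz by auto
    qed
  qed
  then have "card (swallowed N (N s \<union> N p)) \<le> card (set [x, y, s, t, p, q])"
    by (rule card_mono[rotated]) simp
  then show "card (swallowed N (N s \<union> N p)) \<le> 6"
    using card_length[of "[x, y, s, t, p, q]"] by simp
  assume K': "subdivided_K33 (delete_vertices N (N s \<union> N p)) u' x' y' s' t' p' q'"
    and u': "delete_vertices N (N s \<union> N p) u' = {x', y'}"
  have xy': "x' \<noteq> y'" using K' by (auto simp: subdivided_K33_def)
  have nu': "u' \<notin> N s \<union> N p" "N u' - (N s \<union> N p) = {x', y'}"
    using u' by (auto simp: delete_vertices_def split: if_splits)
  have "u' \<noteq> u"
  proof
    assume "u' = u"
    then have "{x', y'} \<subseteq> {c}" using nu'(2) c D by auto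
    then show False using xy' by auto
  qed
  then have "N u' \<inter> (N s \<union> N p) = {}" using only_u nu'(1) by blast
  then show "N u' = {x', y'}" using nu'(2) by blast
qed

lemma ex_reducible_edge:
  assumes edge: "non_isolated N \<noteq> {}"
    and K: "no_subdivided_K33_component N"
  shows "\<exists>x y. y \<in> N x \<and> card (swallowed N (N x \<union> N y)) \<le> 6 \<and>
    no_subdivided_K33_component (delete_vertices N (N x \<union> N y))"
proof (cases "\<exists>u x y s t p q. subdivided_K33 N u x y s t p q")
  case True
  then obtain u x y s t p q where K0: "subdivided_K33 N u x y s t p q" by blast
  then have u: "N u \<noteq> {x, y}" using K unfolding no_subdivided_K33_component_def by blast
  have "no_subdivided_K33_component (delete_vertices N (N s \<union> N p))"
    unfolding no_subdivided_K33_component_def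
  proof (intro allI impI notI)
    fix u' x' y' s' t' p' q'
    assume K': "subdivided_K33 (delete_vertices N (N s \<union> N p)) u' x' y' s' t' p' q'"
      "delete_vertices N (N s \<union> N p) u' = {x', y'}"
    then have "N u' = {x', y'}" by (rule delete_pendant_subdivided_K33(2)[OF K0 u])
    then show False
      using K subdivided_K33_delete_vertices[OF K'(1)]
      unfolding no_subdivided_K33_component_def by blast
  qed
  moreover have "p \<in> N s" using K0 by (auto simp: subdivided_K33_def)
  ultimately show ?thesis using delete_pendant_subdivided_K33(1)[OF K0 u] by blast
next
  case False
  \<comment> \<open>Since \<open>N\<close> has no configuration at all, no deletion leaves one, and
    any cheap edge will do.\<close>
  then have *: "no_subdivided_K33_component (delete_vertices N D)" for D
    using subdivided_K33_delete_vertices by (auto simp: no_subdivided_K33_component_def)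
  have "\<exists>x y. y \<in> N x \<and> card (swallowed N (N x \<union> N y)) \<le> 6"
  proof (rule ccontr)
    assume none: "\<not> ?thesis"
    interpret large_swallowed N
    proof
      fix x y assume "y \<in> N x"
      then have "\<not> card (swallowed N (N x \<union> N y)) \<le> 6" using none by blast
      then show "7 \<le> card (swallowed N (N x \<union> N y))" by simp
    qed
    interpret large_swallowed_cubic N
    proof
      fix v assume "N v \<noteq> {}"
      then obtain a where "a \<in> N v" by blast
      then obtain b where ab: "a \<in> N v" "b \<in> N v" "a \<noteq> b" using no_leaf[of v a] by blast
      then obtain c where c: "N v = {a, b, c}" using neighbours_two by blast
      have "N v \<noteq> {a, b}" using degree_two_subdivided_K33[of v a b] ab(3) False by blast
      then have "c \<noteq> a" "c \<noteq> b" using c by auto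
      then show "card (N v) = 3" using c ab(3) by simp
    qed
    show False using edge no_edge by (auto simp: non_isolated_def)
  qed
  then show ?thesis using * by blast
qed

end

text \<open>The induced matching is encoded by its vertex set: the subgraph induced by
  \<open>S\<close> is 1-regular.\<close>

theorem induced_matching_subcubic:
  assumes "subcubic N"
    and "no_subdivided_K33_component N"
  shows "\<exists>S. finite S \<and> (\<forall>v\<in>S. card (N v \<inter> S) = 1) \<and> card (non_isolated N) \<le> 3 * card S"
  using assms
proof (induction "card (non_isolated N)" arbitrary: N rule: less_induct)
  case less
  interpret subcubic N by fact
  show ?case
  proof (cases "non_isolated N = {}")
    case True
    then show ?thesis by (intro exI[of _ "{}"]) simp
  next
    case False
    obtain x y where yx: "y \<in> N x" and le: "card (swallowed N (N x \<union> N y)) \<le> 6"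
      and K': "no_subdivided_K33_component (delete_vertices N (N x \<union> N y))"
      using ex_reducible_edge[OF False less.prems(2)] by blast
    define D where "D = N x \<union> N y"
    define M where "M = delete_vertices N D"
    have xy: "x \<in> N y" "x \<noteq> y" using yx sym irrefl by blast+
    then have xyD: "x \<in> D" "y \<in> D" using yx by (auto simp: D_def)
    have sub: "non_isolated M \<subseteq> non_isolated N - D"
      by (auto simp: non_isolated_def M_def delete_vertices_def split: if_splits)
    have "x \<in> non_isolated N" using yx by (auto simp: non_isolated_def)
    then have "non_isolated M \<subset> non_isolated N" using sub xyD by blast
    then have "card (non_isolated M) < card (non_isolated N)"
      by (rule psubset_card_mono[OF finite_non_isolated])
    then obtain S where S: "finite S" "\<And>v. v \<in> S \<Longrightarrow> card (M v \<inter> S) = 1"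
      "card (non_isolated M) \<le> 3 * card S"
      using less.hyps[of M] subcubic_delete_vertices K' by (auto simp: M_def D_def)
    \<comment> \<open>Vertices of \<open>S\<close> are not isolated in \<open>M\<close>, so they lie
      outside \<open>D\<close>, which contains every neighbour of \<open>x\<close> and
      \<open>y\<close>. The new edge is therefore not joined to the old ones.\<close>
    have "M v \<noteq> {}" if "v \<in> S" for v using S(2)[OF that] by auto
    then have SD: "S \<inter> D = {}" using sub by (auto simp: non_isolated_def)
    define T where "T = S \<union> {x, y}"
    have "card (N v \<inter> T) = 1" if v: "v \<in> T" for v
    proof (cases "v \<in> S")
      case True
      then have "x \<notin> N v" "y \<notin> N v" using SD sym by (auto simp: D_def)
      then have "N v \<inter> T = M v \<inter> S"
        using True SD by (auto simp: T_def M_def delete_vertices_def)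
      then show ?thesis using S(2)[OF True] by simp
    next
      case False
      then have "v = x \<or> v = y" using v by (auto simp: T_def)
      then have "N v \<inter> T = {if v = x then y else x}"
        using SD yx xy irrefl by (auto simp: T_def D_def)
      then show ?thesis by simp
    qed
    moreover have "finite T" using S(1) by (simp add: T_def)
    moreover have "card (non_isolated N) \<le> 3 * card T"
    proof -
      have "non_isolated N \<subseteq> non_isolated M \<union> swallowed N D"
        by (auto simp: non_isolated_def swallowed_def M_def delete_vertices_def)
      moreover have "finite (swallowed N D)"
        by (rule finite_subset[of _ "D \<union> non_isolated N"])
           (use finite_neighbours finite_non_isolated in
             \<open>auto simp: swallowed_def non_isolated_def D_def\<close>)
      moreover have "finite (non_isolated M)"
        using finite_subset[OF sub] finite_non_isolated by blast
      ultimately have "card (non_isolated N) \<le> card (non_isolated M \<union> swallowed N D)"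
        by (intro card_mono) auto
      also have "\<dots> \<le> card (non_isolated M) + card (swallowed N D)" by (rule card_Un_le)
      also have "\<dots> \<le> 3 * (card S + 2)" using S(3) le by (simp add: D_def)
      also have "card S + 2 = card T"
        using S(1) SD xyD xy(2) by (subst T_def, subst card_Un_disjoint) auto
      finally show ?thesis .
    qed
    ultimately show ?thesis by blast
  qed
qed

section \<open>Bounds for cubic graphs\<close>

context
  fixes G :: "'a pair_pre_digraph"
  assumes cubic: "cubic_graph G"
begin

lemma finite_pverts: "finite (pverts G)"
  using cubic by (simp add: cubic_graph_def pair_graph_def pair_digraph_def pair_fin_digraph_def
      pair_fin_digraph_axioms_def)

lemma parcs_irrefl: "(v, v) \<notin> parcs G"
  using cubic pair_loopfree_digraph.pair_no_loops[of G "(v, v)"]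
  by (auto simp: cubic_graph_def pair_graph_def pair_digraph_def)

lemma parcs_sym: "(u, v) \<in> parcs G \<Longrightarrow> (v, u) \<in> parcs G"
  using cubic by (auto simp: cubic_graph_def pair_graph_def pair_pseudo_graph_def
      pair_sym_digraph_def pair_sym_digraph_axioms_def symmetric_def dest: symD)

lemma parcs_pverts: "(u, v) \<in> parcs G \<Longrightarrow> u \<in> pverts G \<and> v \<in> pverts G"
  using cubic pair_wf_digraph.in_arcsD1[of G u v] pair_wf_digraph.in_arcsD2[of G u v]
  by (auto simp: cubic_graph_def pair_graph_def pair_digraph_def pair_fin_digraph_def)

lemma neighbours_sym: "u \<in> neighbours G v \<Longrightarrow> v \<in> neighbours G u"
  using parcs_sym parcs_pverts by (auto simp: neighbours_def)

lemma card_neighbours: "v \<in> pverts G \<Longrightarrow> card (neighbours G v) = 3"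
proof -
  assume v: "v \<in> pverts G"
  have "out_arcs (with_proj G) v = Pair v ` neighbours G v"
    using parcs_pverts by (auto simp: neighbours_def out_arcs_def)
  then have "out_degree (with_proj G) v = card (neighbours G v)"
    by (simp add: out_degree_def card_image inj_on_def)
  then show ?thesis using cubic v by (simp add: cubic_graph_def)
qed

lemma neighbours_empty: "v \<notin> pverts G \<Longrightarrow> neighbours G v = {}"
  using parcs_pverts by (auto simp: neighbours_def)

lemma non_isolated_neighbours: "non_isolated (neighbours G) = pverts G"
  using card_neighbours neighbours_empty by (fastforce simp: non_isolated_def)

lemma subcubic_neighbours: "subcubic (neighbours G)"
proof
  show "finite (non_isolated (neighbours G))"
    using finite_pverts by (simp add: non_isolated_neighbours)
  show "card (neighbours G v) \<le> 3" for v
    using card_neighbours[of v] neighbours_empty[of v] by (cases "v \<in> pverts G") auto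
  show "v \<in> neighbours G u" if "u \<in> neighbours G v" for u v
    using that by (rule neighbours_sym)
  show "v \<notin> neighbours G v" for v
    using parcs_irrefl by (simp add: neighbours_def)
qed

section \<open>The two inequalities\<close>

lemma ex_light_PID_function: "\<exists>f. PID_function G f \<and> 3 * weight G f \<le> 2 * card (pverts G)"
proof -
  interpret subcubic "neighbours G" by (rule subcubic_neighbours)
  \<comment> \<open>In a cubic graph no vertex has degree 2, so the excluded component cannot
    occur.\<close>
  have "neighbours G u \<noteq> {x, y}" for u x y
    using card_neighbours[of u] neighbours_empty[of u] card_length[of "[x, y]"]
    by (cases "u \<in> pverts G") auto
  then have "no_subdivided_K33_component (neighbours G)"
    by (simp add: no_subdivided_K33_component_def)
  then obtain S where S: "finite S" "\<And>v. v \<in> S \<Longrightarrow> card (neighbours G v \<inter> S) = 1"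
    "card (pverts G) \<le> 3 * card S"
    using induced_matching_subcubic[OF subcubic_neighbours] non_isolated_neighbours by metis
  define f where "f v = (if v \<in> S then 0 else 1 :: nat)" for v
  have sum: "sum f A = card (A - S)" if "finite A" for A
    using that by (simp add: f_def sum.If_cases Diff_eq)
  have "neighbours G v \<noteq> {}" if "v \<in> S" for v using S(2)[OF that] by auto
  then have SV: "S \<subseteq> pverts G" using neighbours_empty by blast
  have "PID_function G f"
    unfolding PID_function_def
  proof (intro conjI ballI impI)
    fix v assume v: "v \<in> pverts G" "f v = 0"
    then have "v \<in> S" by (simp add: f_def split: if_splits)
    then show "sum f (neighbours G v) = 2"
      using S(2)[of v] card_neighbours[OF v(1)] finite_neighbours[of v]
        card_Diff_subset_Int[of "neighbours G v" S] by (simp add: sum)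
  qed (simp add: f_def)
  moreover have "weight G f = card (pverts G) - card S"
    using sum[OF finite_pverts] card_Diff_subset[OF S(1) SV] by (simp add: weight_def)
  ultimately show ?thesis using S(3) by (intro exI[of _ f]) auto
qed

lemma PID_function_weight_ge:
  assumes f: "PID_function G f"
  shows "2 * card (pverts G) \<le> 5 * weight G f"
proof -
  interpret subcubic "neighbours G" by (rule subcubic_neighbours)
  define Z where "Z = {v \<in> pverts G. f v = 0}"
  have Z: "Z \<subseteq> pverts G" "finite Z" using finite_pverts by (auto simp: Z_def)
  have "2 * card Z = (\<Sum>v\<in>Z. \<Sum>u\<in>neighbours G v. f u)"
    using f by (simp add: PID_function_def Z_def)
  also have "\<dots> \<le> (\<Sum>v\<in>pverts G. \<Sum>u\<in>neighbours G v. f u)"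
    using Z finite_pverts by (intro sum_mono2) auto
  also have "\<dots> = (\<Sum>(v, u)\<in>(SIGMA v:pverts G. neighbours G v). f u)"
    using finite_pverts finite_neighbours by (subst sum.Sigma) auto
  \<comment> \<open>Double counting: reversing all arcs turns the sum over neighbours into one in
    which each label is counted three times.\<close>
  also have "\<dots> = (\<Sum>(u, v)\<in>(SIGMA u:pverts G. neighbours G u). f u)"
    by (rule sum.reindex_bij_witness[of _ prod.swap prod.swap])
       (auto simp: neighbours_def dest: parcs_sym)
  also have "\<dots> = (\<Sum>u\<in>pverts G. \<Sum>v\<in>neighbours G u. f u)"
    using finite_pverts finite_neighbours by (subst sum.Sigma) auto
  also have "\<dots> = 3 * weight G f"
    by (simp add: card_neighbours weight_def sum_distrib_left)
  finally have 1: "2 * card Z \<le> 3 * weight G f" .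
  have "card (pverts G - Z) = (\<Sum>v\<in>pverts G - Z. 1)" by simp
  also have "\<dots> \<le> (\<Sum>v\<in>pverts G - Z. f v)" by (rule sum_mono) (auto simp: Z_def)
  also have "\<dots> \<le> weight G f"
    unfolding weight_def using finite_pverts by (intro sum_mono2) auto
  \<comment> \<open>The nonzero vertices number at most the weight \<open>w\<close>, so with
    \<open>n\<close> vertices \<open>n - w\<close> is at most \<open>card Z\<close>, hence at most
    \<open>3 w / 2\<close>.\<close>
  finally have "card (pverts G) - card Z \<le> weight G f" using card_Diff_subset[OF Z(2,1)] by simp
  then show ?thesis using 1 by linarith
qed

lemma ex_minimum_PID_function:
  "\<exists>f. PID_function G f \<and> weight G f = perfect_italian_domination_number G"
  unfolding perfect_italian_domination_number_def
  using ex_light_PID_function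
  by (intro LeastI_ex[of "\<lambda>w. \<exists>f. PID_function G f \<and> weight G f = w"]) blast

lemma perfect_italian_domination_number_le:
  "PID_function G f \<Longrightarrow> perfect_italian_domination_number G \<le> weight G f"
  unfolding perfect_italian_domination_number_def by (rule Least_le) blast

lemma perfect_italian_domination_number_bounds:
  "2 * card (pverts G) \<le> 5 * perfect_italian_domination_number G"
  "3 * perfect_italian_domination_number G \<le> 2 * card (pverts G)"
proof -
  show "2 * card (pverts G) \<le> 5 * perfect_italian_domination_number G"
    using ex_minimum_PID_function PID_function_weight_ge by metis
  obtain f where "PID_function G f" "3 * weight G f \<le> 2 * card (pverts G)"
    using ex_light_PID_function by blast
  then show "3 * perfect_italian_domination_number G \<le> 2 * card (pverts G)"
    using perfect_italian_domination_number_le[of f] by linarith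
qed

end

section \<open>Sharpness\<close>

definition symmetric_graph :: "nat \<Rightarrow> (nat \<Rightarrow> nat \<Rightarrow> bool) \<Rightarrow> nat pair_pre_digraph" where
  "symmetric_graph n E = \<lparr>pverts = {..<n}, parcs = {(i, j). i < n \<and> j < n \<and> E i j}\<rparr>"

lemma cubic_symmetric_graph:
  assumes "\<And>i j. E i j \<Longrightarrow> E j i" "\<And>i. \<not> E i i"
    and "\<And>i. i < n \<Longrightarrow> card {j. j < n \<and> E i j} = 3"
  shows "cubic_graph (symmetric_graph n E)"
proof -
  have "finite {(i, j). i < n \<and> j < n \<and> E i j}"
    by (rule finite_subset[of _ "{..<n} \<times> {..<n}"]) auto
  then have "pair_graph (symmetric_graph n E)"
    using assms(1,2) by unfold_locales (auto simp: symmetric_graph_def symmetric_def sym_def)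
  moreover have "out_degree (with_proj (symmetric_graph n E)) i = 3" if "i < n" for i
  proof -
    have "out_arcs (with_proj (symmetric_graph n E)) i = Pair i ` {j. j < n \<and> E i j}"
      using that by (auto simp: out_arcs_def symmetric_graph_def)
    then show ?thesis using assms(3)[OF that] by (simp add: out_degree_def card_image inj_on_def)
  qed
  ultimately show ?thesis by (simp add: cubic_graph_def) (simp add: symmetric_graph_def)
qed

lemma connected_symmetric_graph:
  assumes sym: "\<And>i j. E i j \<Longrightarrow> E j i" and "n > 0"
    and diam: "\<And>i j. i < n \<Longrightarrow> j < n \<Longrightarrow> i \<noteq> j \<Longrightarrow> E i j \<or> (\<exists>k<n. E i k \<and> E k j)"
  shows "Digraph_Component.connected (with_proj (symmetric_graph n E))"
proof -
  \<comment> \<open>\<open>connected\<close> means strong connectedness of the symmetric closure,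
    which is the graph itself here.\<close>
  have mk: "with_proj (mk_symmetric (with_proj (symmetric_graph n E))) =
      with_proj (symmetric_graph n E)"
    using sym by (auto simp: mk_symmetric_def symmetric_graph_def with_proj_def)
  interpret wf_digraph "with_proj (symmetric_graph n E)"
    by unfold_locales (auto simp: symmetric_graph_def)
  have step: "i \<rightarrow>\<^sup>*\<^bsub>with_proj (symmetric_graph n E)\<^esub> j" if "i < n" "j < n" "E i j" for i j
    by (rule reachable_adjI) (use that in \<open>simp add: symmetric_graph_def\<close>)
  have "i \<rightarrow>\<^sup>*\<^bsub>with_proj (symmetric_graph n E)\<^esub> j" if ij: "i < n" "j < n" for i j
  proof (cases "i = j")
    case True
    then show ?thesis using ij reachable_refl[of i] by (simp add: symmetric_graph_def)
  next
    case False
    from diam[OF ij False] show ?thesis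
    proof (elim disjE exE conjE)
      fix k assume "k < n" "E i k" "E k j"
      then show ?thesis using step ij reachable_trans by blast
    qed (use step ij in blast)
  qed
  then have "strongly_connected (with_proj (symmetric_graph n E))"
    using \<open>n > 0\<close> by (intro strongly_connectedI) (auto simp: symmetric_graph_def)
  then show ?thesis unfolding connected_def mk .
qed

section \<open>The two extremal graphs\<close>

abbreviation "K4 \<equiv> symmetric_graph 4 (\<noteq>)"

abbreviation "K33 \<equiv> symmetric_graph 6 (\<lambda>i j. even i \<noteq> even j)"

lemma cubic_K4: "cubic_graph K4"
proof (rule cubic_symmetric_graph)
  fix i :: nat assume i: "i < 4"
  have "{j. j < 4 \<and> i \<noteq> j} = {..<4} - {i}" by auto
  then show "card {j. j < 4 \<and> i \<noteq> j} = 3" using i by simp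
qed auto

lemma evens_odds_less_6:
  "{j :: nat. j < 6 \<and> even j} = {0, 2, 4}" "{j :: nat. j < 6 \<and> odd j} = {1, 3, 5}"
proof -
  have 6: "j < 6 \<longleftrightarrow> j = 0 \<or> j = 1 \<or> j = 2 \<or> j = 3 \<or> j = 4 \<or> j = 5" for j :: nat by auto
  show "{j :: nat. j < 6 \<and> even j} = {0, 2, 4}" "{j :: nat. j < 6 \<and> odd j} = {1, 3, 5}"
    unfolding 6 by auto
qed

lemma cubic_K33: "cubic_graph K33"
proof (rule cubic_symmetric_graph)
  show "card {j :: nat. j < 6 \<and> even i \<noteq> even j} = 3" for i :: nat
    using evens_odds_less_6 by (cases "even i") auto
qed auto

lemma PID_function_K33_weight_ge:
  assumes f: "PID_function K33 f"
  shows "4 \<le> weight K33 f"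
proof -
  \<comment> \<open>A zero in one part forces the other part to have sum 2; a part without zeros has sum at least 3.\<close>
  define a where "a = f 0 + f 2 + f 4"
  define b where "b = f 1 + f 3 + f 5"
  have nb: "neighbours K33 i = (if even i then {1, 3, 5} else {0, 2, 4})" if "i < 6" for i
  proof -
    have "neighbours K33 i = {j. j < 6 \<and> even i \<noteq> even j}"
      using that by (auto simp: neighbours_def symmetric_graph_def)
    then show ?thesis using evens_odds_less_6 by auto
  qed
  have "(if even i then b else a) = 2" if "i < 6" "f i = 0" for i
  proof -
    have "i \<in> pverts K33" using that by (simp add: symmetric_graph_def)
    then have "sum f (neighbours K33 i) = 2" using f that(2) unfolding PID_function_def by blast
    then show ?thesis unfolding nb[OF that(1)] by (simp add: a_def b_def add.assoc split: if_splits)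
  qed
  from this[of 0] this[of 1] this[of 2] this[of 3] this[of 4] this[of 5]
  have z: "f 0 = 0 \<Longrightarrow> b = 2" "f 1 = 0 \<Longrightarrow> a = 2" "f 2 = 0 \<Longrightarrow> b = 2"
    "f 3 = 0 \<Longrightarrow> a = 2" "f 4 = 0 \<Longrightarrow> b = 2" "f 5 = 0 \<Longrightarrow> a = 2" by simp_all
  have "weight K33 f = a + b"
    by (simp add: weight_def symmetric_graph_def a_def b_def numeral_eq_Suc)
  moreover have "b = 2 \<or> 3 \<le> a" using z unfolding a_def by linarith
  moreover have "a = 2 \<or> 3 \<le> b" using z unfolding b_def by linarith
  ultimately show ?thesis by linarith
qed

theorem theorem30:
  shows "(\<forall>G :: 'a pair_pre_digraph. cubic_graph G \<and> Digraph_Component.connected (with_proj G) \<longrightarrow>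
            2 / 5 * real (card (pverts G)) \<le> real (perfect_italian_domination_number G) \<and>
            real (perfect_italian_domination_number G) \<le> 2 / 3 * real (card (pverts G)))
       \<and> (\<exists>G :: nat pair_pre_digraph. cubic_graph G \<and> Digraph_Component.connected (with_proj G) \<and>
            int (perfect_italian_domination_number G) = \<lceil>2 * real (card (pverts G)) / 5\<rceil>)
       \<and> (\<exists>G :: nat pair_pre_digraph. cubic_graph G \<and> Digraph_Component.connected (with_proj G) \<and>
            real (perfect_italian_domination_number G) = 2 * real (card (pverts G)) / 3)"
proof (intro conjI allI impI)
  fix G :: "'a pair_pre_digraph"
  assume "cubic_graph G \<and> Digraph_Component.connected (with_proj G)"
  then have "cubic_graph G" ..
  note bounds = perfect_italian_domination_number_bounds[OF this]
  show "2 / 5 * real (card (pverts G)) \<le> real (perfect_italian_domination_number G)"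
    "real (perfect_italian_domination_number G) \<le> 2 / 3 * real (card (pverts G))"
    using bounds by linarith+
next
  have card: "card (pverts K4) = 4" by (simp add: symmetric_graph_def)
  \<comment> \<open>The only integer between 8/5 and 8/3 is 2.\<close>
  then have "perfect_italian_domination_number K4 = 2"
    using perfect_italian_domination_number_bounds[OF cubic_K4] by linarith
  moreover have "\<lceil>2 * real 4 / 5\<rceil> = 2" by (simp add: ceiling_eq_iff)
  ultimately have "int (perfect_italian_domination_number K4) = \<lceil>2 * real (card (pverts K4)) / 5\<rceil>"
    using card by simp
  moreover have "Digraph_Component.connected (with_proj K4)"
    by (rule connected_symmetric_graph) auto
  ultimately show "\<exists>G :: nat pair_pre_digraph. cubic_graph G \<and>
      Digraph_Component.connected (with_proj G) \<and>
      int (perfect_italian_domination_number G) = \<lceil>2 * real (card (pverts G)) / 5\<rceil>"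
    using cubic_K4 by blast
next
  have card: "card (pverts K33) = 6" by (simp add: symmetric_graph_def)
  obtain f where "PID_function K33 f" "weight K33 f = perfect_italian_domination_number K33"
    using ex_minimum_PID_function[OF cubic_K33] by blast
  then have "perfect_italian_domination_number K33 = 4"
    using PID_function_K33_weight_ge[of f] perfect_italian_domination_number_bounds(2)[OF cubic_K33]
      card by linarith
  then have "real (perfect_italian_domination_number K33) = 2 * real (card (pverts K33)) / 3"
    using card by simp
  moreover have "Digraph_Component.connected (with_proj K33)"
  proof (rule connected_symmetric_graph)
    fix i j :: nat
    \<comment> \<open>Two vertices of equal parity have 0 or 1 as a common neighbour.\<close>
    have "0 < (6 :: nat) \<and> even (0 :: nat)" "1 < (6 :: nat) \<and> odd (1 :: nat)" by simp_all
    then show "(even i \<noteq> even j) \<or> (\<exists>k<6 :: nat. even i \<noteq> even k \<and> even k \<noteq> even j)" by blast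
  qed auto
  ultimately show "\<exists>G :: nat pair_pre_digraph. cubic_graph G \<and>
      Digraph_Component.connected (with_proj G) \<and>
      real (perfect_italian_domination_number G) = 2 * real (card (pverts G)) / 3"
    using cubic_K33 by blast
qed

end
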